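(* Let $a,b,c,d,u_0,\omega_0\in\mathbb{R}$ with $ad-bc=1$ and $b\neq 0$, let $g\in L^2(\mathbb{R})\setminus\{0\}$ be a window function, and let $f\in L^1(\mathbb{R})\cap L^2(\mathbb{R})$. Then the convolution-based short-time offset linear canonical transform $(u,\tau)\mapsto \mathcal{O}_{g}[f](u,\tau)$ is continuous on $\mathbb{R}^2$.
   Context: For real parameters $M=(a,b,c,d,u_0,\omega_0)$ with $ad-bc=1$, $b\neq 0$, the convolution-based short-time offset linear canonical transform (STOLCT) of $f\in L^2(\mathbb{R})$ with respect to a window $g\in L^2(\mathbb{R})\setminus\{0\}$ is $$\mathcal{O}_{g}[f](u,\tau)=\frac{1}{\sqrt{2\pi i b}}\int_{\mathbb{R}} f(x)\,\overline{g(x-u)}\,e^{-\frac{i a x}{b}(u-x)+\frac{i}{2b}d u_0^2-i\tau x}\,dx,\qquad (u,\tau)\in\mathbb{R}^2,$$ where the square root is the principal one. *)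

theory Defs
  imports "HOL-Analysis.Analysis"
begin

text \<open>
  Elements of \<open>L\<^sup>1(\<real>)\<close> and \<open>L\<^sup>2(\<real>)\<close> are represented by complex-valued Lebesgue measurable functions.
  The zero vector of \<open>L\<^sup>2(\<real>)\<close> is the class of the functions vanishing almost everywhere, and
  \<open>STOLCT\<close> depends only on the classes of \<open>f\<close> and \<open>g\<close>.
\<close>

definition L1 :: "(real \<Rightarrow> complex) set" where
  "L1 = {f. integrable lebesgue f}"

definition L2 :: "(real \<Rightarrow> complex) set" where
  "L2 = {f. f \<in> borel_measurable lebesgue \<and> integrable lebesgue (\<lambda>x. (cmod (f x))\<^sup>2)}"

definition L2_zero :: "(real \<Rightarrow> complex) set" where
  "L2_zero = {f \<in> L2. AE x in lebesgue. f x = 0}"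

text \<open>
  The parameters \<open>c\<close> and \<open>\<omega>\<^sub>0\<close> do not occur in the kernel; they are kept because the transform is
  attached to the full parameter tuple \<open>(a, b, c, d, u\<^sub>0, \<omega>\<^sub>0)\<close>. The root \<open>csqrt\<close> is the principal one.
\<close>

definition STOLCT ::
  "real \<Rightarrow> real \<Rightarrow> real \<Rightarrow> real \<Rightarrow> real \<Rightarrow> real \<Rightarrow>
    (real \<Rightarrow> complex) \<Rightarrow> (real \<Rightarrow> complex) \<Rightarrow> real \<Rightarrow> real \<Rightarrow> complex" where
  "STOLCT a b c d u\<^sub>0 \<omega>\<^sub>0 g f u \<tau> =
     1 / csqrt (2 * complex_of_real pi * \<i> * complex_of_real b) *
     (LINT x|lebesgue. f x * cnj (g (x - u)) *
        exp (- (\<i> * complex_of_real a * complex_of_real x / complex_of_real b)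
                 * (complex_of_real u - complex_of_real x)
             + \<i> / (2 * complex_of_real b) * complex_of_real d * (complex_of_real u\<^sub>0)\<^sup>2
             - \<i> * complex_of_real \<tau> * complex_of_real x))"

end

theory Submission
  imports Defs
begin

text \<open>
  The transform \<open>STOLCT a b c d u\<^sub>0 \<omega>\<^sub>0 g f u \<tau>\<close> is, up to a constant, the \<open>L\<^sup>2\<close> pairing of \<open>f\<close> times
  a chirp of modulus one with the translated window \<open>x \<mapsto> cnj (g (x - u))\<close>. Both factors depend
  continuously on the parameters as elements of \<open>L\<^sup>2\<close>: the first by dominated convergence, since the
  chirp is continuous in \<open>(u, \<tau>)\<close> and bounded, and the second because translation is strongly
  continuous on \<open>L\<^sup>2\<close>. The pairing is jointly continuous by Cauchy-Schwarz
  (\<open>integral_mult_tendsto_of_L2\<close>).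

  Continuity of translation is first proved in \<open>L\<^sup>1\<close> (\<open>translation_continuous_L1\<close>). It holds for
  indicators of open sets of finite measure by dominated convergence, and it is preserved under \<open>L\<^sup>1\<close> limits because
  translations are isometries; outer regularity and the density of simple functions give the rest.
  It is carried over to \<open>L\<^sup>2\<close> (\<open>translation_continuous_L2\<close>) without a second density argument: the map
  \<open>z \<mapsto> \<bar>z\<bar> z\<close> sends \<open>L\<^sup>2\<close> into \<open>L\<^sup>1\<close>, and its inverse is Hoelder continuous with exponent
  one half (\<open>norm_diff_square_le\<close>), so that \<open>L\<^sup>2\<close> distances are controlled by \<open>L\<^sup>1\<close> distances.
\<close>

section \<open>Continuity of translation in \<open>L\<^sup>1\<close>\<close>

lemma integrable_lebesgue_translation:
  fixes f :: "real \<Rightarrow> 'a::euclidean_space"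
  assumes "integrable lebesgue f"
  shows "integrable lebesgue (\<lambda>x. f (x - t))"
  using lebesgue_integrable_real_affine_iff[of 1 f "- t"] assms by simp

lemma integral_lebesgue_translation:
  fixes f :: "real \<Rightarrow> 'a::euclidean_space"
  shows "(LINT x|lebesgue. f (x - t)) = (LINT x|lebesgue. f x)"
  using lebesgue_integral_real_affine[of 1 f "- t"] by simp

lemma measurable_lebesgue_translation:
  fixes f :: "real \<Rightarrow> 'a::topological_space"
  assumes "f \<in> borel_measurable lebesgue"
  shows "(\<lambda>x. f (x - t)) \<in> borel_measurable lebesgue"
proof -
  have "(\<lambda>x. - t + 1 * x) \<in> lebesgue \<rightarrow>\<^sub>M (lebesgue :: real measure)"
    using lebesgue_affine_measurable[of "\<lambda>_::real. 1" "- t"] by simp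
  from measurable_compose[OF this assms] show ?thesis by simp
qed

text \<open>
  Translations are isometries of \<open>L\<^sup>1\<close>, so an error \<open>f - g\<close> enters the translation modulus of \<open>f\<close>
  at most twice, uniformly in the translation. Hence the functions whose translates by \<open>h n\<close>
  converge back to them form a closed subset of \<open>L\<^sup>1\<close>.
\<close>

lemma translation_continuous_L1_closed:
  fixes f :: "real \<Rightarrow> 'a::euclidean_space"
  assumes f: "integrable lebesgue f"
    and approx: "\<And>e. e > 0 \<Longrightarrow> \<exists>g. integrable lebesgue g \<and> (LINT x|lebesgue. norm (f x - g x)) < e \<and>
        (\<lambda>n. LINT x|lebesgue. norm (g (x - h n) - g x)) \<longlonglongrightarrow> 0"
  shows "(\<lambda>n. LINT x|lebesgue. norm (f (x - h n) - f x)) \<longlonglongrightarrow> 0"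
proof (rule LIMSEQ_I)
  fix r :: real assume "r > 0"
  then obtain g where g: "integrable lebesgue g"
    and fg: "(LINT x|lebesgue. norm (f x - g x)) < r / 3"
    and lim: "(\<lambda>n. LINT x|lebesgue. norm (g (x - h n) - g x)) \<longlonglongrightarrow> 0"
    using approx[of "r / 3"] by auto
  obtain N where N: "\<And>n. n \<ge> N \<Longrightarrow> norm ((LINT x|lebesgue. norm (g (x - h n) - g x)) - 0) < r / 3"
    using LIMSEQ_D[OF lim, of "r / 3"] \<open>r > 0\<close> by auto
  have "norm ((LINT x|lebesgue. norm (f (x - h n) - f x)) - 0) < r" if "n \<ge> N" for n
  proof -
    note intf = integrable_lebesgue_translation[OF f] and intg = integrable_lebesgue_translation[OF g]
    have i1: "integrable lebesgue (\<lambda>x. norm (f x - g x))"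
      by (intro Bochner_Integration.integrable_norm Bochner_Integration.integrable_diff f g intf intg)
    have i2: "integrable lebesgue (\<lambda>x. norm (f (x - h n) - g (x - h n)))"
      by (intro Bochner_Integration.integrable_norm Bochner_Integration.integrable_diff f g intf intg)
    have i3: "integrable lebesgue (\<lambda>x. norm (g (x - h n) - g x))"
      by (intro Bochner_Integration.integrable_norm Bochner_Integration.integrable_diff f g intf intg)
    have "(LINT x|lebesgue. norm (f (x - h n) - f x)) \<le>
        (LINT x|lebesgue. norm (f (x - h n) - g (x - h n)) + norm (g (x - h n) - g x) + norm (f x - g x))"
    proof (rule integral_mono)
      show "integrable lebesgue (\<lambda>x. norm (f (x - h n) - f x))"
        by (intro Bochner_Integration.integrable_norm Bochner_Integration.integrable_diff f g intf intg)
      show "integrable lebesgue (\<lambda>x. norm (f (x - h n) - g (x - h n)) + norm (g (x - h n) - g x) + norm (f x - g x))"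
        by (intro Bochner_Integration.integrable_add i1 i2 i3)
      show "norm (f (x - h n) - f x) \<le>
          norm (f (x - h n) - g (x - h n)) + norm (g (x - h n) - g x) + norm (f x - g x)" for x
        by norm
    qed
    also have "\<dots> = (LINT x|lebesgue. norm (f (x - h n) - g (x - h n)))
        + (LINT x|lebesgue. norm (g (x - h n) - g x)) + (LINT x|lebesgue. norm (f x - g x))"
      using i1 i2 i3 by simp
    also have "(LINT x|lebesgue. norm (f (x - h n) - g (x - h n))) = (LINT x|lebesgue. norm (f x - g x))"
      by (rule integral_lebesgue_translation)
    finally show ?thesis
      using N[OF that] fg by simp
  qed
  then show "\<exists>N. \<forall>n\<ge>N. norm ((LINT x|lebesgue. norm (f (x - h n) - f x)) - 0) < r"
    by blast
qed

text \<open>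
  A point of an open set \<open>T\<close> stays in \<open>T\<close> under small translations, so the positive part of
  \<open>indicator T x - indicator T (x - h n)\<close> tends to zero everywhere, dominated by \<open>indicator T\<close>.
  The negative part need not converge everywhere, but it has the same integral, because \<open>T\<close> and its
  translate have the same measure.
\<close>

lemma translation_continuous_L1_indicator_open:
  fixes T :: "real set"
  assumes T: "open T" "T \<in> lmeasurable" and h: "h \<longlonglongrightarrow> 0"
  shows "(\<lambda>n. LINT x|lebesgue. norm (indicat_real T (x - h n) - indicat_real T x)) \<longlonglongrightarrow> 0"
proof -
  have int: "integrable lebesgue (indicat_real T)"
    using T(2) by (simp add: lmeasurable_iff_integrable)
  note int_h = integrable_lebesgue_translation[OF int]
  define p where "p n x = max 0 (indicat_real T x - indicat_real T (x - h n))" for n x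
  have p_int: "integrable lebesgue (p n)" for n
    unfolding p_def using int int_h by auto
  have "(\<lambda>n. LINT x|lebesgue. p n x) \<longlonglongrightarrow> integral\<^sup>L lebesgue (\<lambda>x::real. 0::real)"
  proof (rule Bochner_Integration.integral_dominated_convergence[where w = "indicat_real T"])
    show "AE x in lebesgue. (\<lambda>n. p n x) \<longlonglongrightarrow> 0"
    proof (rule AE_I2)
      fix x :: real
      show "(\<lambda>n. p n x) \<longlonglongrightarrow> 0"
      proof (cases "x \<in> T")
        case True
        have "(\<lambda>n. x - h n) \<longlonglongrightarrow> x"
          using tendsto_diff[OF tendsto_const h, of x] by simp
        then have "eventually (\<lambda>n. x - h n \<in> T) sequentially"
          using T(1) True by (rule topological_tendstoD)
        then have "eventually (\<lambda>n. p n x = 0) sequentially"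
          by eventually_elim (auto simp: p_def)
        then show ?thesis
          by (rule tendsto_eventually)
      qed (simp add: p_def)
    qed
    show "AE x in lebesgue. norm (p n x) \<le> indicat_real T x" for n
      by (auto simp: p_def indicator_def)
  qed (use int p_int in auto)
  then have lim: "(\<lambda>n. 2 * (LINT x|lebesgue. p n x)) \<longlonglongrightarrow> 0"
    using tendsto_mult_right_zero by force
  have "(LINT x|lebesgue. norm (indicat_real T (x - h n) - indicat_real T x))
      = 2 * (LINT x|lebesgue. p n x)" for n
  proof -
    have "(LINT x|lebesgue. norm (indicat_real T (x - h n) - indicat_real T x))
        = (LINT x|lebesgue. indicat_real T (x - h n) - indicat_real T x + 2 * p n x)"
      by (rule Bochner_Integration.integral_cong) (auto simp: p_def indicator_def)
    also have "\<dots> = (LINT x|lebesgue. indicat_real T (x - h n)) - (LINT x|lebesgue. indicat_real T x)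
        + 2 * (LINT x|lebesgue. p n x)"
      using int int_h p_int by simp
    also have "(LINT x|lebesgue. indicat_real T (x - h n)) = (LINT x|lebesgue. indicat_real T x)"
      by (rule integral_lebesgue_translation)
    finally show ?thesis by simp
  qed
  with lim show ?thesis by simp
qed

lemma translation_continuous_L1_indicator:
  fixes A :: "real set"
  assumes A: "A \<in> lmeasurable" and h: "h \<longlonglongrightarrow> 0"
  shows "(\<lambda>n. LINT x|lebesgue. norm (indicat_real A (x - h n) - indicat_real A x)) \<longlonglongrightarrow> 0"
proof (rule translation_continuous_L1_closed)
  show "integrable lebesgue (indicat_real A)"
    using A by (simp add: lmeasurable_iff_integrable)
  fix e :: real assume "e > 0"
  obtain T where T: "open T" "A \<subseteq> T" "T - A \<in> lmeasurable" "emeasure lebesgue (T - A) < ennreal e"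
    using sets_lebesgue_outer_open[OF fmeasurableD[OF A] \<open>e > 0\<close>] by metis
  have "T \<in> lmeasurable"
    using fmeasurable.Un[OF A T(3)] T(2) by (simp add: Un_absorb1)
  have "(LINT x|lebesgue. norm (indicat_real A x - indicat_real T x))
      = (LINT x|lebesgue. indicat_real (T - A) x)"
    using T(2) by (intro Bochner_Integration.integral_cong) (auto simp: indicator_def)
  also have "\<dots> = measure lebesgue (T - A)"
    by simp
  also have "\<dots> < e"
    using T(3,4) \<open>e > 0\<close> by (simp add: emeasure_eq_measure2 ennreal_less_iff)
  finally show "\<exists>g. integrable lebesgue g \<and> (LINT x|lebesgue. norm (indicat_real A x - g x)) < e \<and>
      (\<lambda>n. LINT x|lebesgue. norm (g (x - h n) - g x)) \<longlonglongrightarrow> 0"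
    using translation_continuous_L1_indicator_open[OF T(1) \<open>T \<in> lmeasurable\<close> h] \<open>T \<in> lmeasurable\<close>
    by (intro exI[of _ "indicat_real T"]) (simp add: lmeasurable_iff_integrable)
qed

theorem translation_continuous_L1:
  fixes f :: "real \<Rightarrow> 'a::euclidean_space"
  assumes f: "integrable lebesgue f" and h: "h \<longlonglongrightarrow> 0"
  shows "(\<lambda>n. LINT x|lebesgue. norm (f (x - h n) - f x)) \<longlonglongrightarrow> 0"
  using f
proof (induction rule: integrable_induct)
  case (base A c)
  then have "A \<in> lmeasurable"
    by (simp add: fmeasurable_def)
  from tendsto_mult_right[OF translation_continuous_L1_indicator[OF this h], of "norm c"]
  show ?case
    by (simp flip: scaleR_diff_left)
next
  case (add f g)
  note intf = integrable_lebesgue_translation[OF add.hyps(1)] add.hyps(1)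
  note intg = integrable_lebesgue_translation[OF add.hyps(2)] add.hyps(2)
  have bound: "(LINT x|lebesgue. norm (f (x - h n) + g (x - h n) - (f x + g x)))
      \<le> (LINT x|lebesgue. norm (f (x - h n) - f x)) + (LINT x|lebesgue. norm (g (x - h n) - g x))" for n
  proof -
    have "(LINT x|lebesgue. norm (f (x - h n) + g (x - h n) - (f x + g x)))
        \<le> (LINT x|lebesgue. norm (f (x - h n) - f x) + norm (g (x - h n) - g x))"
      using intf intg by (intro integral_mono) (auto intro: norm_diff_triangle_ineq)
    then show ?thesis
      using intf intg by simp
  qed
  have "(\<lambda>n. (LINT x|lebesgue. norm (f (x - h n) - f x)) + (LINT x|lebesgue. norm (g (x - h n) - g x))) \<longlonglongrightarrow> 0"
    using tendsto_add[OF add.IH] by simp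
  then show ?case
    by (rule Lim_null_comparison[rotated]) (use bound in auto)
next
  case (lim f s)
  show ?case
  proof (rule translation_continuous_L1_closed[OF lim.hyps(4)])
    fix e :: real assume "e > 0"
    \<comment> \<open>The approximating sequence satisfies \<open>norm (s i x) \<le> 2 * norm (f x)\<close>, whence the factor 3.\<close>
    have "(\<lambda>i. LINT x|lebesgue. norm (f x - s i x)) \<longlonglongrightarrow> integral\<^sup>L lebesgue (\<lambda>x::real. 0::real)"
    proof (rule Bochner_Integration.integral_dominated_convergence[where w = "\<lambda>x. 3 * norm (f x)"])
      show "AE x in lebesgue. (\<lambda>i. norm (f x - s i x)) \<longlonglongrightarrow> 0"
      proof (rule AE_I2)
        fix x :: real
        have "(\<lambda>i. f x - s i x) \<longlonglongrightarrow> f x - f x"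
          using lim.hyps(2)[of x] by (intro tendsto_intros) simp
        then show "(\<lambda>i. norm (f x - s i x)) \<longlonglongrightarrow> 0"
          by (simp add: tendsto_norm_zero)
      qed
      show "AE x in lebesgue. norm (norm (f x - s i x)) \<le> 3 * norm (f x)" for i
      proof (rule AE_I2)
        fix x :: real
        show "norm (norm (f x - s i x)) \<le> 3 * norm (f x)"
          using lim.hyps(3)[of x i] norm_triangle_ineq4[of "f x" "s i x"] by simp
      qed
      show "integrable lebesgue (\<lambda>x. 3 * norm (f x))"
        using lim.hyps(4) by auto
      show "(\<lambda>x. norm (f x - s i x)) \<in> borel_measurable lebesgue" for i
        by (intro borel_measurable_integrable Bochner_Integration.integrable_norm
            Bochner_Integration.integrable_diff lim.hyps)
    qed simp
    then have "eventually (\<lambda>i. (LINT x|lebesgue. norm (f x - s i x)) < e) sequentially"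
      using \<open>e > 0\<close> by (auto intro: order_tendstoD)
    then obtain i where "(LINT x|lebesgue. norm (f x - s i x)) < e"
      by (auto simp: eventually_sequentially)
    with lim.hyps(1) lim.IH show "\<exists>g. integrable lebesgue g \<and> (LINT x|lebesgue. norm (f x - g x)) < e \<and>
        (\<lambda>n. LINT x|lebesgue. norm (g (x - h n) - g x)) \<longlonglongrightarrow> 0"
      by blast
  qed
qed

section \<open>Square-integrable functions\<close>

definition square_integrable :: "'a measure \<Rightarrow> ('a \<Rightarrow> 'b::{banach, second_countable_topology}) \<Rightarrow> bool" where
  "square_integrable M f \<longleftrightarrow> f \<in> borel_measurable M \<and> integrable M (\<lambda>x. (norm (f x))\<^sup>2)"

lemma square_integrable_measurable:
  "square_integrable M f \<Longrightarrow> f \<in> borel_measurable M"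
  by (simp add: square_integrable_def)

lemma square_integrable_diff:
  assumes f: "square_integrable M f" and g: "square_integrable M g"
  shows "square_integrable M (\<lambda>x. f x - g x)"
  unfolding square_integrable_def
proof
  show meas: "(\<lambda>x. f x - g x) \<in> borel_measurable M"
    by (intro borel_measurable_diff square_integrable_measurable f g)
  have "(norm (f x - g x))\<^sup>2 \<le> 2 * (norm (f x))\<^sup>2 + 2 * (norm (g x))\<^sup>2" for x
  proof -
    have "(norm (f x - g x))\<^sup>2 \<le> (norm (f x) + norm (g x))\<^sup>2"
      by (intro power_mono norm_triangle_ineq4) auto
    also have "\<dots> \<le> 2 * (norm (f x))\<^sup>2 + 2 * (norm (g x))\<^sup>2"
      using zero_le_power2[of "norm (f x) - norm (g x)"] by (simp add: power2_eq_square algebra_simps)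
    finally show ?thesis .
  qed
  moreover have "integrable M (\<lambda>x. 2 * (norm (f x))\<^sup>2 + 2 * (norm (g x))\<^sup>2)"
    using f g by (auto simp: square_integrable_def)
  ultimately show "integrable M (\<lambda>x. (norm (f x - g x))\<^sup>2)"
    using meas by (elim Bochner_Integration.integrable_bound) auto
qed

lemma
  fixes f g :: "'a \<Rightarrow> 'b::{banach, second_countable_topology, real_normed_algebra}"
  assumes f: "square_integrable M f" and g: "square_integrable M g"
  shows integrable_mult_square_integrable: "integrable M (\<lambda>x. f x * g x)"
    and Cauchy_Schwarz_integral:
      "norm (LINT x|M. f x * g x) \<le> sqrt (LINT x|M. (norm (f x))\<^sup>2) * sqrt (LINT x|M. (norm (g x))\<^sup>2)"
proof -
  note [measurable] = square_integrable_measurable[OF f] square_integrable_measurable[OF g]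
  have sq: "(\<integral>\<^sup>+x. (ennreal (norm (k x)))\<^sup>2 \<partial>M) = ennreal (LINT x|M. (norm (k x))\<^sup>2)"
    if "square_integrable M k" for k :: "'a \<Rightarrow> 'b"
    using that by (simp add: square_integrable_def ennreal_power nn_integral_eq_integral)
  let ?F = "LINT x|M. (norm (f x))\<^sup>2" and ?G = "LINT x|M. (norm (g x))\<^sup>2"
  have "(\<integral>\<^sup>+x. ennreal (norm (f x)) * ennreal (norm (g x)) \<partial>M)\<^sup>2 \<le> ennreal ?F * ennreal ?G"
    using Cauchy_Schwarz_nn_integral[of "\<lambda>x. ennreal (norm (f x))" M "\<lambda>x. ennreal (norm (g x))"]
    by (simp add: sq[OF f] sq[OF g])
  then have le: "(\<integral>\<^sup>+x. ennreal (norm (f x) * norm (g x)) \<partial>M)\<^sup>2 \<le> ennreal (?F * ?G)"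
    by (simp add: ennreal_mult)
  also have "\<dots> < \<infinity>"
    by simp
  finally have "(\<integral>\<^sup>+x. ennreal (norm (f x) * norm (g x)) \<partial>M) < \<infinity>"
    by (simp add: power_less_top_ennreal)
  then have int: "integrable M (\<lambda>x. norm (f x) * norm (g x))"
    by (intro integrableI_bounded) (auto simp: abs_mult)
  show fg: "integrable M (\<lambda>x. f x * g x)"
    by (rule Bochner_Integration.integrable_bound[OF int]) (auto simp: norm_mult_ineq)
  have "norm (LINT x|M. f x * g x) \<le> (LINT x|M. norm (f x) * norm (g x))"
    using fg int by (intro order_trans[OF integral_norm_bound] integral_mono norm_mult_ineq) auto
  also have "\<dots> \<le> sqrt (?F * ?G)"
  proof (rule real_le_rsqrt)
    have "ennreal ((LINT x|M. norm (f x) * norm (g x))\<^sup>2) \<le> ennreal (?F * ?G)"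
      using le int by (simp add: nn_integral_eq_integral ennreal_power)
    then show "(LINT x|M. norm (f x) * norm (g x))\<^sup>2 \<le> ?F * ?G"
      by (subst (asm) ennreal_le_iff) auto
  qed
  finally show "norm (LINT x|M. f x * g x) \<le> sqrt ?F * sqrt ?G"
    by (simp add: real_sqrt_mult)
qed

text \<open>
  Write \<open>f' n * g' n - f * g\<close> as \<open>(f' n - f) * (g' n - g) + (f' n - f) * g + f * (g' n - g)\<close>.
  Cauchy-Schwarz applies to each term, and only the fixed norms of \<open>f\<close> and \<open>g\<close> occur as factors
  next to the vanishing ones.
\<close>

lemma integral_mult_tendsto_of_L2:
  fixes f g :: "'a \<Rightarrow> 'b::{banach, second_countable_topology, real_normed_algebra}"
  assumes f: "square_integrable M f" "\<And>n. square_integrable M (f' n)"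
    and g: "square_integrable M g" "\<And>n. square_integrable M (g' n)"
    and lim_f: "(\<lambda>n. LINT x|M. (norm (f' n x - f x))\<^sup>2) \<longlonglongrightarrow> 0"
    and lim_g: "(\<lambda>n. LINT x|M. (norm (g' n x - g x))\<^sup>2) \<longlonglongrightarrow> 0"
  shows "(\<lambda>n. LINT x|M. f' n x * g' n x) \<longlonglongrightarrow> (LINT x|M. f x * g x)"
proof -
  let ?N = "\<lambda>k. sqrt (LINT x|M. (norm (k x))\<^sup>2)"
  note df = square_integrable_diff[OF f(2) f(1)] and dg = square_integrable_diff[OF g(2) g(1)]
  have bound: "norm ((LINT x|M. f' n x * g' n x) - (LINT x|M. f x * g x))
      \<le> ?N (\<lambda>x. f' n x - f x) * ?N (\<lambda>x. g' n x - g x) + ?N (\<lambda>x. f' n x - f x) * ?N g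
        + ?N f * ?N (\<lambda>x. g' n x - g x)" for n
  proof -
    note int = integrable_mult_square_integrable
    have "(LINT x|M. f' n x * g' n x) - (LINT x|M. f x * g x)
        = (LINT x|M. f' n x * g' n x - f x * g x)"
      using int[OF f(2) g(2)] int[OF f(1) g(1)] by simp
    also have "\<dots> = (LINT x|M. (f' n x - f x) * (g' n x - g x) + (f' n x - f x) * g x + f x * (g' n x - g x))"
      by (simp add: algebra_simps)
    also have "\<dots> = (LINT x|M. (f' n x - f x) * (g' n x - g x)) + (LINT x|M. (f' n x - f x) * g x)
        + (LINT x|M. f x * (g' n x - g x))"
      using int[OF df[of n] dg[of n]] int[OF df[of n] g(1)] int[OF f(1) dg[of n]]
      by (simp only: Bochner_Integration.integral_add Bochner_Integration.integrable_add)
    finally have eq: "(LINT x|M. f' n x * g' n x) - (LINT x|M. f x * g x)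
        = (LINT x|M. (f' n x - f x) * (g' n x - g x)) + (LINT x|M. (f' n x - f x) * g x)
        + (LINT x|M. f x * (g' n x - g x))" .
    have "norm ((LINT x|M. f' n x * g' n x) - (LINT x|M. f x * g x))
        \<le> norm (LINT x|M. (f' n x - f x) * (g' n x - g x))
        + norm (LINT x|M. (f' n x - f x) * g x) + norm (LINT x|M. f x * (g' n x - g x))"
      unfolding eq by (rule norm_triangle_le[OF add_right_mono[OF norm_triangle_ineq]])
    also have "\<dots> \<le> ?N (\<lambda>x. f' n x - f x) * ?N (\<lambda>x. g' n x - g x) + ?N (\<lambda>x. f' n x - f x) * ?N g
        + ?N f * ?N (\<lambda>x. g' n x - g x)"
      by (intro add_mono Cauchy_Schwarz_integral df dg f g)
    finally show ?thesis .
  qed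
  have "(\<lambda>n. ?N (\<lambda>x. f' n x - f x) * ?N (\<lambda>x. g' n x - g x) + ?N (\<lambda>x. f' n x - f x) * ?N g
        + ?N f * ?N (\<lambda>x. g' n x - g x)) \<longlonglongrightarrow> sqrt 0 * sqrt 0 + sqrt 0 * ?N g + ?N f * sqrt 0"
    by (intro tendsto_intros lim_f lim_g)
  then have lim: "(\<lambda>n. ?N (\<lambda>x. f' n x - f x) * ?N (\<lambda>x. g' n x - g x) + ?N (\<lambda>x. f' n x - f x) * ?N g
        + ?N f * ?N (\<lambda>x. g' n x - g x)) \<longlonglongrightarrow> 0"
    by (simp only: real_sqrt_zero mult_zero_left mult_zero_right add_0_left)
  have "(\<lambda>n. (LINT x|M. f' n x * g' n x) - (LINT x|M. f x * g x)) \<longlonglongrightarrow> 0"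
    by (rule Lim_null_comparison[OF always_eventually lim]) (rule allI, rule bound)
  then show ?thesis
    by (rule LIM_zero_cancel)
qed

section \<open>Continuity of translation in \<open>L\<^sup>2\<close>\<close>

text \<open>
  With \<open>r = norm a\<close>, \<open>s = norm b\<close> and \<open>t = a \<bullet> b\<close>, the pairing of \<open>r a - s b\<close> with \<open>a - b\<close> equals
  \<open>(r + s) (r\<^sup>2 + s\<^sup>2 - r s - t)\<close>. Here \<open>r + s \<ge> norm (a - b)\<close>, and the second factor is at least
  \<open>(r\<^sup>2 + s\<^sup>2) / 2 - t = (norm (a - b))\<^sup>2 / 2\<close>, because \<open>r s \<le> (r\<^sup>2 + s\<^sup>2) / 2\<close>. Cauchy-Schwarz
  bounds the pairing from above, and one factor \<open>norm (a - b)\<close> cancels.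
\<close>

lemma norm_diff_square_le:
  fixes a b :: "'a::real_inner"
  shows "(norm (a - b))\<^sup>2 \<le> 2 * norm (norm a *\<^sub>R a - norm b *\<^sub>R b)"
proof (cases "a = b")
  case False
  define r s t where "r = norm a" and "s = norm b" and "t = a \<bullet> b"
  have aa: "a \<bullet> a = r\<^sup>2" and bb: "b \<bullet> b = s\<^sup>2"
    by (simp_all add: r_def s_def dot_square_norm)
  have D: "(norm (a - b))\<^sup>2 = r\<^sup>2 + s\<^sup>2 - 2 * t"
    by (simp add: power2_norm_eq_inner inner_diff aa bb t_def inner_commute)
  have "norm (a - b) * (norm (a - b))\<^sup>2 \<le> (r + s) * (2 * (r\<^sup>2 + s\<^sup>2 - r * s - t))"
  proof (intro mult_mono)
    show "norm (a - b) \<le> r + s"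
      by (simp add: r_def s_def norm_triangle_ineq4)
    show "(norm (a - b))\<^sup>2 \<le> 2 * (r\<^sup>2 + s\<^sup>2 - r * s - t)"
      unfolding D using zero_le_power2[of "r - s"] by (simp add: power2_eq_square algebra_simps)
  qed (auto simp: r_def s_def)
  also have "\<dots> = 2 * ((r *\<^sub>R a - s *\<^sub>R b) \<bullet> (a - b))"
    by (simp add: inner_diff aa bb t_def inner_commute[of b a] power2_eq_square algebra_simps)
  also have "\<dots> \<le> 2 * (norm (r *\<^sub>R a - s *\<^sub>R b) * norm (a - b))"
    by (simp add: norm_cauchy_schwarz)
  finally have "norm (a - b) * (norm (a - b))\<^sup>2 \<le> norm (a - b) * (2 * norm (r *\<^sub>R a - s *\<^sub>R b))"
    by (simp add: algebra_simps)
  with False show ?thesis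
    by (simp add: r_def s_def)
qed simp

lemma square_integrable_translation:
  fixes g :: "real \<Rightarrow> 'a::euclidean_space"
  assumes "square_integrable lebesgue g"
  shows "square_integrable lebesgue (\<lambda>x. g (x - t))"
  using assms measurable_lebesgue_translation[of g t]
    integrable_lebesgue_translation[of "\<lambda>x. (norm (g x))\<^sup>2" t]
  by (auto simp: square_integrable_def)

theorem translation_continuous_L2:
  fixes g :: "real \<Rightarrow> 'a::euclidean_space"
  assumes g: "square_integrable lebesgue g" and u: "u \<longlonglongrightarrow> v"
  shows "(\<lambda>n. LINT x|lebesgue. (norm (g (x - u n) - g (x - v)))\<^sup>2) \<longlonglongrightarrow> 0"
proof -
  define k where "k x = norm (g x) *\<^sub>R g x" for x
  define h where "h n = u n - v" for n
  have h: "h \<longlonglongrightarrow> 0"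
    unfolding h_def using u by (rule LIM_zero)
  note [measurable] = square_integrable_measurable[OF g]
  have k: "integrable lebesgue k"
  proof (rule Bochner_Integration.integrable_bound)
    show "integrable lebesgue (\<lambda>x. (norm (g x))\<^sup>2)"
      using g by (simp add: square_integrable_def)
    show "k \<in> borel_measurable lebesgue"
      unfolding k_def by measurable
  qed (simp add: k_def power2_eq_square)
  have bound: "(LINT x|lebesgue. (norm (g (x - u n) - g (x - v)))\<^sup>2)
      \<le> 2 * (LINT x|lebesgue. norm (k (x - h n) - k x))" for n
  proof -
    have "(LINT x|lebesgue. (norm (g (x - u n) - g (x - v)))\<^sup>2)
        = (LINT x|lebesgue. (norm (g (x - h n) - g x))\<^sup>2)"
      using integral_lebesgue_translation[of "\<lambda>x. (norm (g (x - h n) - g x))\<^sup>2" v]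
      by (simp add: h_def algebra_simps)
    also have "\<dots> \<le> (LINT x|lebesgue. 2 * norm (k (x - h n) - k x))"
    proof (rule integral_mono)
      show "integrable lebesgue (\<lambda>x. (norm (g (x - h n) - g x))\<^sup>2)"
        using square_integrable_diff[OF square_integrable_translation[OF g] g]
        by (simp add: square_integrable_def)
      show "integrable lebesgue (\<lambda>x. 2 * norm (k (x - h n) - k x))"
        using k integrable_lebesgue_translation[OF k] by auto
    qed (simp add: k_def norm_diff_square_le)
    finally show ?thesis by simp
  qed
  have "(\<lambda>n. 2 * (LINT x|lebesgue. norm (k (x - h n) - k x))) \<longlonglongrightarrow> 0"
    using tendsto_mult_right_zero[OF translation_continuous_L1[OF k h]] by simp
  then show ?thesis
    by (rule Lim_null_comparison[rotated]) (use bound in auto)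
qed

section \<open>Continuity of the transform\<close>

text \<open>
  Pointwise convergence of the multipliers suffices: unimodularity supplies the dominating function
  \<open>4 * (norm (f x))\<^sup>2\<close>.
\<close>

lemma unimodular_multiplier_tendsto_L2:
  fixes f :: "'a \<Rightarrow> 'b::{banach, second_countable_topology, real_normed_div_algebra}"
  assumes f: "square_integrable M f"
    and meas: "\<And>n. e' n \<in> borel_measurable M" "e \<in> borel_measurable M"
    and unimodular: "\<And>n x. norm (e' n x) = 1" "\<And>x. norm (e x) = 1"
    and lim: "\<And>x. (\<lambda>n. e' n x) \<longlonglongrightarrow> e x"
  shows "(\<lambda>n. LINT x|M. (norm (f x * e' n x - f x * e x))\<^sup>2) \<longlonglongrightarrow> 0"
proof -
  note [measurable] = square_integrable_measurable[OF f] meas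
  have "(\<lambda>n. LINT x|M. (norm (f x * e' n x - f x * e x))\<^sup>2) \<longlonglongrightarrow> (LINT x|M. (0::real))"
  proof (rule Bochner_Integration.integral_dominated_convergence[where w = "\<lambda>x. 4 * (norm (f x))\<^sup>2"])
    show "integrable M (\<lambda>x. 4 * (norm (f x))\<^sup>2)"
      using f by (simp add: square_integrable_def)
    show "AE x in M. (\<lambda>n. (norm (f x * e' n x - f x * e x))\<^sup>2) \<longlonglongrightarrow> 0"
    proof (rule AE_I2)
      fix x
      have "(\<lambda>n. (norm (f x * e' n x - f x * e x))\<^sup>2) \<longlonglongrightarrow> (norm (f x * e x - f x * e x))\<^sup>2"
        by (intro tendsto_intros lim)
      then show "(\<lambda>n. (norm (f x * e' n x - f x * e x))\<^sup>2) \<longlonglongrightarrow> 0"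
        by simp
    qed
    show "AE x in M. norm ((norm (f x * e' n x - f x * e x))\<^sup>2) \<le> 4 * (norm (f x))\<^sup>2" for n
    proof (rule AE_I2)
      fix x
      have "norm (f x * e' n x - f x * e x) \<le> 2 * norm (f x)"
        using norm_triangle_ineq4[of "f x * e' n x" "f x * e x"] by (simp add: norm_mult unimodular)
      from power_mono[OF this norm_ge_zero, of 2]
      show "norm ((norm (f x * e' n x - f x * e x))\<^sup>2) \<le> 4 * (norm (f x))\<^sup>2"
        by (simp add: power_mult_distrib)
    qed
  qed measurable
  then show ?thesis by simp
qed

theorem lemma3p4:
  fixes a b c d u\<^sub>0 \<omega>\<^sub>0 :: real and f g :: "real \<Rightarrow> complex"
  assumes "a * d - b * c = 1" and "b \<noteq> 0"
    and "g \<in> L2 - L2_zero"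
    and "f \<in> L1 \<inter> L2"
  shows "continuous_on (UNIV :: (real \<times> real) set) (\<lambda>(u, \<tau>). STOLCT a b c d u\<^sub>0 \<omega>\<^sub>0 g f u \<tau>)"
proof -
  have f: "square_integrable lebesgue f" and g: "square_integrable lebesgue g"
    using assms(3,4) by (auto simp: L2_def square_integrable_def)
  define E where "E u \<tau> x = exp (- (\<i> * complex_of_real a * complex_of_real x / complex_of_real b)
                 * (complex_of_real u - complex_of_real x)
             + \<i> / (2 * complex_of_real b) * complex_of_real d * (complex_of_real u\<^sub>0)\<^sup>2
             - \<i> * complex_of_real \<tau> * complex_of_real x)" for u \<tau> x :: real
  have E_norm: "norm (E u \<tau> x) = 1" for u \<tau> x
  proof -
    have "E u \<tau> x = exp (\<i> * complex_of_real (- (a * x / b) * (u - x) + d * u\<^sub>0\<^sup>2 / (2 * b) - \<tau> * x))"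
      unfolding E_def by (rule arg_cong[where f = exp]) (simp add: algebra_simps)
    then show ?thesis
      by simp
  qed
  have E_meas [measurable]: "E u \<tau> \<in> borel_measurable lebesgue" for u \<tau>
  proof -
    have "continuous_on UNIV (E u \<tau>)"
      unfolding E_def divide_inverse by (intro continuous_intros)
    then show ?thesis
      by (intro measurable_completion) (simp add: borel_measurable_continuous_onI)
  qed
  have fE: "square_integrable lebesgue (\<lambda>x. f x * E u \<tau> x)" for u \<tau>
    using f by (auto simp: square_integrable_def norm_mult E_norm)
  have cg: "square_integrable lebesgue (\<lambda>x. cnj (g (x - u)))" for u
  proof -
    have "cnj \<in> borel_measurable borel"
      by (intro borel_measurable_continuous_onI continuous_intros)
    then show ?thesis
      using square_integrable_translation[OF g, of u]
      by (auto simp: square_integrable_def intro: measurable_compose)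
  qed
  have "(\<lambda>n. STOLCT a b c d u\<^sub>0 \<omega>\<^sub>0 g f (u n) (\<tau> n)) \<longlonglongrightarrow> STOLCT a b c d u\<^sub>0 \<omega>\<^sub>0 g f u' \<tau>'"
    if u: "u \<longlonglongrightarrow> u'" and \<tau>: "\<tau> \<longlonglongrightarrow> \<tau>'" for u \<tau> u' \<tau>'
  proof -
    have E_lim: "(\<lambda>n. E (u n) (\<tau> n) x) \<longlonglongrightarrow> E u' \<tau>' x" for x
      unfolding E_def by (intro tendsto_intros u \<tau>)
    have "(\<lambda>n. LINT x|lebesgue. (f x * E (u n) (\<tau> n) x) * cnj (g (x - u n)))
        \<longlonglongrightarrow> (LINT x|lebesgue. (f x * E u' \<tau>' x) * cnj (g (x - u')))"
    proof (rule integral_mult_tendsto_of_L2[OF fE fE cg cg])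
      show "(\<lambda>n. LINT x|lebesgue. (norm (f x * E (u n) (\<tau> n) x - f x * E u' \<tau>' x))\<^sup>2) \<longlonglongrightarrow> 0"
        by (rule unimodular_multiplier_tendsto_L2[OF f E_meas E_meas E_norm E_norm E_lim])
      show "(\<lambda>n. LINT x|lebesgue. (norm (cnj (g (x - u n)) - cnj (g (x - u'))))\<^sup>2) \<longlonglongrightarrow> 0"
        using translation_continuous_L2[OF g u] by (simp flip: complex_cnj_diff)
    qed
    then show ?thesis
      unfolding STOLCT_def E_def[symmetric]
      by (intro tendsto_intros) (simp add: mult_ac)
  qed
  from this[OF tendsto_fst tendsto_snd] show ?thesis
    by (fastforce simp: continuous_on_sequentially o_def split_beta)
qed

end
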